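(* As $n \to \infty$, the proportion of matroids with ground set $[n]$ that are representable tends to zero; that is, if $m(n)$ denotes the number of matroids with ground set $[n]$ and $\rho(n)$ denotes the number of representable matroids with ground set $[n]$, then $\lim_{n\to\infty} \rho(n)/m(n) = 0$.
   Context: Here $[n] = \{1,\dotsc,n\}$. A matroid is a pair $M = (E,\mathcal{B})$, where $E$ is a finite ground set and $\mathcal{B}$ is a nonempty collection of subsets of $E$ (the bases of $M$) satisfying the exchange axiom: for all $B, B' \in \mathcal{B}$ and all $e \in B' \setminus B$, there exists $f \in B \setminus B'$ such that $(B \cup \{e\}) \setminus \{f\} \in \mathcal{B}$. All bases have the same cardinality $r$, called the rank of $M$. For a field $\mathbb{F}$, a matroid $M = (E,\mathcal{B})$ of rank $r$ is $\mathbb{F}$-representable if there is a matrix $A \in \mathbb{F}^{[r]\times E}$ such that $\mathcal{B} = \{B \in \binom{E}{r} : A[B] \text{ is nonsingular}\}$, where $\binom{E}{r}$ is the set of $r$-element subsets of $E$ and $A[B]$ is the $r \times r$ submatrix of $A$ with column set $B$. A matroid is representable if it is $\mathbb{F}$-representable for at least one field $\mathbb{F}$. Matroids with ground set $[n]$ are counted as labelled objects: two matroids on $[n]$ are distinct if their collections of bases differ (they are not counted up to isomorphism). *)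

theory Defs
  imports
    Complex_Main
    "HOL-Library.Countable_Set"
    "HOL-Combinatorics.Permutations"
    "HOL-Algebra.Algebra"
begin

section \<open>Matroids\<close>

definition matroid :: "'e set \<Rightarrow> 'e set set \<Rightarrow> bool" where
  "matroid E \<B> \<longleftrightarrow>
     finite E \<and> \<B> \<noteq> {} \<and> (\<forall>B\<in>\<B>. B \<subseteq> E) \<and>
     (\<forall>B\<in>\<B>. \<forall>B'\<in>\<B>. \<forall>e\<in>B' - B. \<exists>f\<in>B - B'. (B \<union> {e}) - {f} \<in> \<B>)"

text \<open>All bases have the same size, so the choice of basis below is immaterial
  (see \<open>card_basis\<close>).\<close>

definition matroid_rank :: "'e set set \<Rightarrow> nat" where
  "matroid_rank \<B> = card (SOME B. B \<in> \<B>)"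

lemma card_basis_le:
  assumes "matroid E \<B>" "B \<in> \<B>" "B' \<in> \<B>"
  shows "card B' \<le> card B"
  using assms(2)
proof (induction "card (B' - B)" arbitrary: B rule: less_induct)
  case less
  have finE: "finite E" and sub: "\<And>B. B \<in> \<B> \<Longrightarrow> B \<subseteq> E"
    using assms(1) by (auto simp: matroid_def)
  have fin: "finite B" "finite B'"
    using finite_subset[OF sub finE] less.prems assms(3) by auto
  show ?case
  proof (cases "B' \<subseteq> B")
    case True
    then show ?thesis using fin by (simp add: card_mono)
  next
    case False
    then obtain e where e: "e \<in> B' - B" by blast
    then obtain f where f: "f \<in> B - B'" "(B \<union> {e}) - {f} \<in> \<B>"
      using assms(1,3) less.prems unfolding matroid_def by blast
    let ?C = "(B \<union> {e}) - {f}"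
    have "B' - ?C \<subset> B' - B" using e f by blast
    then have "card (B' - ?C) < card (B' - B)"
      using fin by (intro psubset_card_mono) auto
    then have "card B' \<le> card ?C" using f(2) less.hyps by blast
    also have "card ?C = card B"
      using e f fin by (auto simp: card_Diff_singleton)
    finally show ?thesis .
  qed
qed

lemma card_basis:
  assumes "matroid E \<B>" "B \<in> \<B>"
  shows "card B = matroid_rank \<B>"
proof -
  have "(SOME B. B \<in> \<B>) \<in> \<B>" using assms(2) by (rule someI)
  then show ?thesis
    unfolding matroid_rank_def using card_basis_le[OF assms(1)] assms(2) by (meson le_antisym)
qed


section \<open>Nonsingular submatrices over an arbitrary field\<close>

text \<open>The fields range over the locale \<open>field\<close> (carrier and operations as data) rather than the
  type class, so that representability can quantify over them.\<close>

definition ring_det :: "('k, 'm) ring_scheme \<Rightarrow> nat \<Rightarrow> (nat \<Rightarrow> nat \<Rightarrow> 'k) \<Rightarrow> 'k" where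
  "ring_det R r M =
     (\<Oplus>\<^bsub>R\<^esub> p \<in> {p. p permutes {1..r}}.
        if evenperm p then (\<Otimes>\<^bsub>R\<^esub> i \<in> {1..r}. M i (p i))
        else \<ominus>\<^bsub>R\<^esub> (\<Otimes>\<^bsub>R\<^esub> i \<in> {1..r}. M i (p i)))"

text \<open>\<open>A[B]\<close>: the columns indexed by \<open>B\<close>, in increasing order. Any other order would only change
  the sign of the determinant.\<close>

definition column_submatrix ::
    "(nat \<Rightarrow> 'e::linorder \<Rightarrow> 'k) \<Rightarrow> 'e set \<Rightarrow> nat \<Rightarrow> nat \<Rightarrow> 'k" where
  "column_submatrix A B i j = A i (sorted_list_of_set B ! (j - 1))"

definition representable_over ::
    "('k, 'm) ring_scheme \<Rightarrow> 'e::linorder set \<Rightarrow> 'e set set \<Rightarrow> bool" where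
  "representable_over F E \<B> \<longleftrightarrow>
     (\<exists>A. (\<forall>i\<in>{1..matroid_rank \<B>}. \<forall>e\<in>E. A i e \<in> carrier F) \<and>
          \<B> = {B. B \<subseteq> E \<and> card B = matroid_rank \<B> \<and>
                   ring_det F (matroid_rank \<B>) (column_submatrix A B) \<noteq> \<zero>\<^bsub>F\<^esub>})"

text \<open>HOL cannot quantify over types inside a formula, so the fields considered are those whose
  carrier is a set of elements of a given type \<open>'k\<close>. For infinite \<open>'k\<close> this loses nothing:
  by \<open>representable_over_imp_representable\<close>, a matroid that is representable over some field of
  whatever type is representable in this sense.\<close>

definition representable :: "'k itself \<Rightarrow> 'e::linorder set \<Rightarrow> 'e set set \<Rightarrow> bool" where
  "representable _ E \<B> \<longleftrightarrow> (\<exists>F :: 'k ring. field F \<and> representable_over F E \<B>)"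


section \<open>Independence of the carrier type\<close>

lemma countable_generate_field:
  assumes "countable H"
  shows "countable (generate_field R H)"
proof -
  define step where "step = (\<lambda>T. T \<union> (\<lambda>h. \<ominus>\<^bsub>R\<^esub> h) ` T \<union> (\<lambda>h. inv\<^bsub>R\<^esub> h) ` T
     \<union> (\<lambda>(a, b). a \<oplus>\<^bsub>R\<^esub> b) ` (T \<times> T) \<union> (\<lambda>(a, b). a \<otimes>\<^bsub>R\<^esub> b) ` (T \<times> T))"
  define T where "T = (\<lambda>n. (step ^^ n) (insert \<one>\<^bsub>R\<^esub> H))"
  have T0: "T 0 = insert \<one>\<^bsub>R\<^esub> H" and TS: "\<And>n. T (Suc n) = step (T n)"
    by (simp_all add: T_def)
  have cT: "countable (T n)" for n
    by (induction n) (auto simp: T0 TS step_def assms)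
  have mono: "m \<le> n \<Longrightarrow> T m \<subseteq> T n" for m n
    by (rule lift_Suc_mono_le[of T]) (auto simp: TS step_def)
  have two: "\<exists>n. a \<in> T n \<and> b \<in> T n" if "a \<in> T m" "b \<in> T k" for a b m k
    using that mono[of m "max m k"] mono[of k "max m k"] by (intro exI[of _ "max m k"]) auto
  have "x \<in> (\<Union>n. T n)" if "x \<in> generate_field R H" for x
    using that
  proof (induction rule: generate_field.induct)
    case one
    then show ?case using T0 by blast
  next
    case (incl h)
    then show ?case using T0 by blast
  next
    case (a_inv h)
    then obtain n where "h \<in> T n" by blast
    then have "\<ominus>\<^bsub>R\<^esub> h \<in> T (Suc n)" by (auto simp: TS step_def)
    then show ?case by blast
  next
    case (m_inv h)
    then obtain n where "h \<in> T n" by blast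
    then have "inv\<^bsub>R\<^esub> h \<in> T (Suc n)" by (auto simp: TS step_def)
    then show ?case by blast
  next
    case (eng_add a b)
    then obtain n where "a \<in> T n" "b \<in> T n" using two by blast
    then have "a \<oplus>\<^bsub>R\<^esub> b \<in> T (Suc n)" by (force simp: TS step_def)
    then show ?case by blast
  next
    case (eng_mult a b)
    then obtain n where "a \<in> T n" "b \<in> T n" using two by blast
    then have "a \<otimes>\<^bsub>R\<^esub> b \<in> T (Suc n)" by (force simp: TS step_def)
    then show ?case by blast
  qed
  then have "generate_field R H \<subseteq> (\<Union>n. T n)" by blast
  then show ?thesis using cT by (meson countable_UN countable_subset UNIV_I countableI_type)
qed

lemma column_submatrix_in:
  assumes "\<forall>i\<in>{1..r}. \<forall>e\<in>E. A i e \<in> K" "B \<subseteq> E" "card B = r" "finite B"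
    and "i \<in> {1..r}" "j \<in> {1..r}"
  shows "column_submatrix A B i j \<in> K"
proof -
  have "sorted_list_of_set B ! (j - 1) \<in> set (sorted_list_of_set B)"
    using assms(3,6) by (intro nth_mem) auto
  then show ?thesis using assms by (auto simp: column_submatrix_def)
qed

lemma (in ring_hom_cring) ring_det_closed_hom:
  assumes M: "\<And>i j. i \<in> {1..r} \<Longrightarrow> j \<in> {1..r} \<Longrightarrow> M i j \<in> carrier R"
  shows "ring_det R r M \<in> carrier R"
    and "h (ring_det R r M) = ring_det S r (\<lambda>i j. h (M i j))"
proof -
  let ?P = "{p. p permutes {1..r}}"
  have Mp: "M i (p i) \<in> carrier R" if "p \<in> ?P" "i \<in> {1..r}" for p i
    using that permutes_in_image[of p "{1..r}"] by (intro M) auto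
  have prod_in: "(\<Otimes>i\<in>{1..r}. M i (p i)) \<in> carrier R" if "p \<in> ?P" for p
    using Mp[OF that] by (intro R.finprod_closed) auto
  have prod_hom: "h (\<Otimes>i\<in>{1..r}. M i (p i)) = (\<Otimes>\<^bsub>S\<^esub>i\<in>{1..r}. h (M i (p i)))" if "p \<in> ?P" for p
    using Mp[OF that] by (subst hom_finprod) (auto simp: comp_def)
  have prod_in': "(\<Otimes>\<^bsub>S\<^esub>i\<in>{1..r}. h (M i (p i))) \<in> carrier S" if "p \<in> ?P" for p
    using Mp[OF that] by (intro S.finprod_closed) auto
  show "ring_det R r M \<in> carrier R"
    unfolding ring_det_def using prod_in by (intro R.finsum_closed) auto
  show "h (ring_det R r M) = ring_det S r (\<lambda>i j. h (M i j))"
    unfolding ring_det_def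
    apply (subst hom_finsum)
    subgoal using prod_in by auto
    subgoal
      using prod_in prod_in' prod_hom by (intro S.finsum_cong') auto
    done
qed

lemma representable_over_hom:
  assumes F: "field F" and Q: "field Q" and h: "h \<in> ring_hom Q F"
    and inj: "inj_on h (carrier Q)"
    and fin: "finite E"
    and A: "\<forall>i\<in>{1..matroid_rank \<B>}. \<forall>e\<in>E. A i e \<in> carrier Q"
    and eq: "\<B> = {B. B \<subseteq> E \<and> card B = matroid_rank \<B> \<and>
        ring_det F (matroid_rank \<B>) (column_submatrix (\<lambda>i e. h (A i e)) B) \<noteq> \<zero>\<^bsub>F\<^esub>}"
  shows "representable_over Q E \<B>"
proof -
  interpret F: field F by fact
  interpret Q: field Q by fact
  interpret H: ring_hom_cring Q F h
    by unfold_locales (rule h)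
  let ?r = "matroid_rank \<B>"
  have *: "ring_det Q ?r (column_submatrix A B) \<noteq> \<zero>\<^bsub>Q\<^esub> \<longleftrightarrow>
      ring_det F ?r (column_submatrix (\<lambda>i e. h (A i e)) B) \<noteq> \<zero>\<^bsub>F\<^esub>"
    if "B \<subseteq> E" "card B = ?r" for B
  proof -
    have "\<And>i j. i \<in> {1..?r} \<Longrightarrow> j \<in> {1..?r} \<Longrightarrow> column_submatrix A B i j \<in> carrier Q"
      using column_submatrix_in[OF A that finite_subset[OF that(1) fin]] by blast
    from H.ring_det_closed_hom[OF this]
    have "ring_det Q ?r (column_submatrix A B) \<in> carrier Q"
      "h (ring_det Q ?r (column_submatrix A B)) =
         ring_det F ?r (column_submatrix (\<lambda>i e. h (A i e)) B)"
      by (simp_all add: column_submatrix_def[abs_def])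
    then show ?thesis
      using inj_onD[OF inj] Q.zero_closed H.hom_zero by metis
  qed
  show ?thesis
    unfolding representable_over_def
    apply (rule exI[of _ A])
    using A eq * by (smt (verit) Collect_cong)
qed

theorem representable_over_imp_representable:
  fixes F :: "('f, 'm) ring_scheme" and \<B> :: "'e::linorder set set"
  assumes F: "field F" and rep: "representable_over F E \<B>" and fin: "finite E"
    and inf: "infinite (UNIV :: 'k set)"
  shows "representable TYPE('k) E \<B>"
proof -
  interpret F: field F by fact
  let ?r = "matroid_rank \<B>"
  obtain A where A: "\<forall>i\<in>{1..?r}. \<forall>e\<in>E. A i e \<in> carrier F"
    and eq: "\<B> = {B. B \<subseteq> E \<and> card B = ?r \<and> ring_det F ?r (column_submatrix A B) \<noteq> \<zero>\<^bsub>F\<^esub>}"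
    using rep unfolding representable_over_def by blast
  define H where "H = (\<lambda>(i, e). A i e) ` ({1..?r} \<times> E)"
  define K where "K = generate_field F H"
  have H: "H \<subseteq> carrier F" using A by (auto simp: H_def)
  have "countable H" using fin by (auto simp: H_def intro: countable_finite)
  then have "countable K" unfolding K_def by (rule countable_generate_field)
  have AK: "A i e \<in> K" if "i \<in> {1..?r}" "e \<in> E" for i e
    unfolding K_def using that by (intro generate_field.incl) (auto simp: H_def)
  have K: "K \<subseteq> carrier F" unfolding K_def by (rule F.generate_field_incl[OF H])
  define FK where "FK = F\<lparr>carrier := K\<rparr>"
  have FK: "field FK" unfolding FK_def K_def by (rule F.generate_field_is_field[OF H])
  then interpret FK: field FK .
  have cFK: "carrier FK = K" by (simp add: FK_def)
  obtain c :: "nat \<Rightarrow> 'k" where c: "inj c"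
    using infinite_countable_subset[OF inf] by blast
  define g where "g = c \<circ> to_nat_on K"
  have g: "inj_on g (carrier FK)"
    unfolding g_def cFK
    using inj_on_to_nat_on[OF \<open>countable K\<close>] c by (auto intro: comp_inj_on inj_on_subset)
  define Q where "Q = image_ring g FK"
  have Q: "field Q" unfolding Q_def by (rule FK.inj_imp_image_ring_is_field[OF g])
  have iso: "g \<in> ring_iso FK Q" unfolding Q_def by (rule inj_imp_image_ring_iso[OF g])
  have cQ: "carrier Q = g ` K" by (simp add: Q_def image_ring_carrier cFK)
  define h where "h = inv_into (carrier FK) g"
  have "h \<in> ring_iso Q FK" unfolding h_def by (rule ring_iso_set_sym[OF FK.ring_axioms iso])
  then have hhom: "h \<in> ring_hom Q FK" and hbij: "bij_betw h (carrier Q) (carrier FK)"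
    by (auto simp: ring_iso_def)
  have h: "h \<in> ring_hom Q F"
    using hhom K by (auto simp: ring_hom_def FK_def Pi_iff)
  have hinj: "inj_on h (carrier Q)" using hbij by (rule bij_betw_imp_inj_on)
  have hg: "h (g x) = x" if "x \<in> K" for x
    using that g by (simp add: h_def cFK)
  define A' where "A' = (\<lambda>i e. g (A i e))"
  have A'Q: "\<forall>i\<in>{1..?r}. \<forall>e\<in>E. A' i e \<in> carrier Q"
    using AK by (auto simp: A'_def cQ)
  have det_eq: "ring_det F ?r (column_submatrix (\<lambda>i e. h (A' i e)) B) =
      ring_det F ?r (column_submatrix A B)" if B: "B \<subseteq> E" "card B = ?r" for B
  proof -
    have same: "column_submatrix (\<lambda>i e. h (A' i e)) B i j = column_submatrix A B i j"
      and inF: "column_submatrix A B i j \<in> carrier F"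
      if "i \<in> {1..?r}" "j \<in> {1..?r}" for i j
    proof -
      have "column_submatrix A B i j \<in> K"
        using AK B that finite_subset[OF B(1) fin] by (intro column_submatrix_in) auto
      then show "column_submatrix (\<lambda>i e. h (A' i e)) B i j = column_submatrix A B i j"
        "column_submatrix A B i j \<in> carrier F"
        using hg K by (auto simp: column_submatrix_def A'_def)
    qed
    have pin: "p i \<in> {1..?r}" if "p permutes {1..?r}" "i \<in> {1..?r}" for p i
      using that permutes_in_image[of p "{1..?r}"] by blast
    have "(\<Otimes>\<^bsub>F\<^esub>i\<in>{1..?r}. column_submatrix (\<lambda>i e. h (A' i e)) B i (p i)) =
        (\<Otimes>\<^bsub>F\<^esub>i\<in>{1..?r}. column_submatrix A B i (p i))"
      and "(\<Otimes>\<^bsub>F\<^esub>i\<in>{1..?r}. column_submatrix A B i (p i)) \<in> carrier F"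
      if "p permutes {1..?r}" for p
      subgoal using same inF pin[OF that] by (intro F.finprod_cong') auto
      subgoal using inF pin[OF that] by (intro F.finprod_closed) auto
      done
    then show ?thesis
      unfolding ring_det_def by (intro F.finsum_cong') auto
  qed
  have "\<B> = {B. B \<subseteq> E \<and> card B = ?r \<and>
      ring_det F ?r (column_submatrix (\<lambda>i e. h (A' i e)) B) \<noteq> \<zero>\<^bsub>F\<^esub>}"
    using eq det_eq by (smt (verit) Collect_cong)
  then have "representable_over Q E \<B>"
    by (rule representable_over_hom[OF F Q h hinj fin A'Q])
  then show ?thesis
    unfolding representable_def using Q by blast
qed


section \<open>Counting labelled matroids\<close>

definition num_matroids :: "nat \<Rightarrow> nat" where
  "num_matroids n = card {\<B>. matroid {1..n} \<B>}"

definition num_representable_matroids :: "'k itself \<Rightarrow> nat \<Rightarrow> nat" where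
  "num_representable_matroids k n = card {\<B>. matroid {1..n} \<B> \<and> representable k {1..n} \<B>}"

end

theory Submission
  imports Defs "HOL-Number_Theory.Cong" "HOL-Real_Asymp.Real_Asymp"
begin

text \<open>
  Upper bound (Nelson; Ronyai, Babai and Ganapathy): a representable matroid of rank \<open>r\<close> on \<open>[n]\<close> is
  the nonvanishing pattern, at some point of some field, of the \<open>n choose r\<close> maximal minors of a
  generic \<open>r \<times> n\<close> matrix. If \<open>k\<close> patterns \<open>S\<close> occur, then the \<open>2 ^ k\<close> subset sums of the products
  \<open>g\<^sub>S\<close> of the minors in \<open>S\<close> are distinct polynomials, and there are too few polynomials of bounded
  degree and coefficients unless \<open>k \<le> 2 ^ O(n\<^sup>3)\<close>. The coefficients are integers, so all
  characteristics are treated at once.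

  Lower bound (Knuth; Graham and Sloane): the \<open>r\<close>-subsets of \<open>[n]\<close> with a prescribed sum modulo \<open>n\<close>
  pairwise differ in more than one exchange, so every subfamily of them is the set of
  nonbases of a (sparse paving) matroid. For \<open>r = n div 2\<close> some residue class has
  at least \<open>2 ^ n / (n * (n + 1))\<close> members.
\<close>

section \<open>Zero patterns of polynomials\<close>

text \<open>Polynomials with natural coefficients, as lists of monomials; a monomial is the list of its
  variables. Like terms are not collected, and equality is equality of multisets of multisets.\<close>

definition monom_eval :: "('k, 'm) ring_scheme \<Rightarrow> ('v \<Rightarrow> 'k) \<Rightarrow> 'v list \<Rightarrow> 'k" where
  "monom_eval R u m = foldr (\<otimes>\<^bsub>R\<^esub>) (map u m) \<one>\<^bsub>R\<^esub>"

definition poly_eval :: "('k, 'm) ring_scheme \<Rightarrow> ('v \<Rightarrow> 'k) \<Rightarrow> 'v list list \<Rightarrow> 'k" where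
  "poly_eval R u P = foldr (\<oplus>\<^bsub>R\<^esub>) (map (monom_eval R u) P) \<zero>\<^bsub>R\<^esub>"

definition poly_times :: "'v list list \<Rightarrow> 'v list list \<Rightarrow> 'v list list" where
  "poly_times P Q = concat (map (\<lambda>m. map ((@) m) Q) P)"

text \<open>As like terms are not collected, \<open>L\<close> bounds the sum of the coefficients and
  \<open>D\<close> the degree; up to order, only finitely many such polynomials exist over a finite
  \<open>V\<close>.\<close>

definition poly_bounded :: "'v set \<Rightarrow> nat \<Rightarrow> nat \<Rightarrow> 'v list list \<Rightarrow> bool" where
  "poly_bounded V L D P \<longleftrightarrow> length P \<le> L \<and> (\<forall>m\<in>set P. length m \<le> D \<and> set m \<subseteq> V)"

section \<open>Length and degree of sums and products\<close>

lemma poly_boundedD: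
  "poly_bounded V L D P \<Longrightarrow> m \<in> set P \<Longrightarrow> set m \<subseteq> V"
  by (auto simp: poly_bounded_def)

lemma poly_bounded_mono:
  "poly_bounded V L D P \<Longrightarrow> L \<le> L' \<Longrightarrow> D \<le> D' \<Longrightarrow> poly_bounded V L' D' P"
  by (fastforce simp: poly_bounded_def)

lemma poly_bounded_append:
  "poly_bounded V L D P \<Longrightarrow> poly_bounded V L' D Q \<Longrightarrow> poly_bounded V (L + L') D (P @ Q)"
  by (auto simp: poly_bounded_def)

lemma length_poly_times: "length (poly_times P Q) = length P * length Q"
  by (induction P) (auto simp: poly_times_def)

lemma poly_bounded_times:
  assumes "poly_bounded V L D P" "poly_bounded V L' D' Q"
  shows "poly_bounded V (L * L') (D + D') (poly_times P Q)"
proof -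
  have "length (poly_times P Q) \<le> L * L'"
    using assms unfolding length_poly_times poly_bounded_def by (intro mult_le_mono) auto
  then show ?thesis
    using assms by (fastforce simp: poly_bounded_def poly_times_def intro: add_le_mono)
qed

section \<open>Folds in commutative monoids\<close>

lemma mset_foldr_cong:
  assumes "comm_monoid G" "mset xs = mset ys" "f ` set xs \<subseteq> carrier G"
  shows "foldr (\<otimes>\<^bsub>G\<^esub>) (map f xs) \<one>\<^bsub>G\<^esub> = foldr (\<otimes>\<^bsub>G\<^esub>) (map f ys) \<one>\<^bsub>G\<^esub>"
  using assms by (intro comm_monoid.multlist_perm_cong) (auto simp: mset_map)

text \<open>Stated for monoids so that it also serves sums, through the additive monoid of a
  ring.\<close>

lemma (in comm_monoid) finprod_set_eq_foldr:
  assumes "distinct xs" "f ` set xs \<subseteq> carrier G"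
  shows "finprod G f (set xs) = foldr (\<otimes>) (map f xs) \<one>"
  using assms by (induction xs) (auto simp: image_subset_iff_funcset)

section \<open>Evaluation in a commutative ring\<close>

context cring
begin

lemma monom_eval_closed: "u \<in> V \<rightarrow> carrier R \<Longrightarrow> set m \<subseteq> V \<Longrightarrow> monom_eval R u m \<in> carrier R"
  by (induction m) (auto simp: monom_eval_def)

lemma monom_eval_append:
  "u \<in> V \<rightarrow> carrier R \<Longrightarrow> set m \<subseteq> V \<Longrightarrow> set m' \<subseteq> V \<Longrightarrow>
     monom_eval R u (m @ m') = monom_eval R u m \<otimes> monom_eval R u m'"
proof (induction m)
  case Nil
  then show ?case using monom_eval_closed[of u V m'] by (simp add: monom_eval_def)
next
  case (Cons a m)
  then have "u a \<in> carrier R" "monom_eval R u m \<in> carrier R" "monom_eval R u m' \<in> carrier R"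
    using monom_eval_closed by auto
  with Cons show ?case by (auto simp: monom_eval_def m_assoc)
qed

lemma poly_eval_closed:
  "u \<in> V \<rightarrow> carrier R \<Longrightarrow> poly_bounded V L D P \<Longrightarrow> poly_eval R u P \<in> carrier R"
proof (induction P arbitrary: L)
  case Nil
  then show ?case by (simp add: poly_eval_def)
next
  case (Cons m P)
  have "poly_bounded V L D P" using Cons.prems by (auto simp: poly_bounded_def)
  then have "poly_eval R u P \<in> carrier R" using Cons by blast
  moreover have "monom_eval R u m \<in> carrier R"
    using Cons.prems by (intro monom_eval_closed) (auto simp: poly_bounded_def)
  ultimately show ?case by (simp add: poly_eval_def)
qed

lemma poly_eval_append:
  assumes "u \<in> V \<rightarrow> carrier R" "poly_bounded V L D P" "poly_bounded V L' D' Q"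
  shows "poly_eval R u (P @ Q) = poly_eval R u P \<oplus> poly_eval R u Q"
  using assms(2)
proof (induction P)
  case Nil
  then show ?case using poly_eval_closed[OF assms(1,3)] by (simp add: poly_eval_def)
next
  case (Cons m P)
  have P: "poly_bounded V L D P" using Cons.prems by (auto simp: poly_bounded_def)
  have "monom_eval R u m \<in> carrier R"
    using Cons.prems assms(1) by (intro monom_eval_closed) (auto simp: poly_bounded_def)
  then show ?case
    using Cons.IH[OF P] poly_eval_closed[OF assms(1) P] poly_eval_closed[OF assms(1,3)]
    by (simp add: poly_eval_def a_assoc)
qed

lemma poly_eval_map_append:
  assumes "u \<in> V \<rightarrow> carrier R" "set m \<subseteq> V" "poly_bounded V L D Q"
  shows "poly_eval R u (map ((@) m) Q) = monom_eval R u m \<otimes> poly_eval R u Q"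
  using assms(3)
proof (induction Q)
  case Nil
  then show ?case using monom_eval_closed[OF assms(1,2)] by (simp add: poly_eval_def)
next
  case (Cons m' Q)
  have Q: "poly_bounded V L D Q" and m': "set m' \<subseteq> V"
    using Cons.prems by (auto simp: poly_bounded_def)
  show ?case
    using Cons.IH[OF Q] poly_eval_closed[OF assms(1) Q] monom_eval_append[OF assms(1,2) m']
      monom_eval_closed[OF assms(1,2)] monom_eval_closed[OF assms(1) m']
    by (simp add: poly_eval_def r_distr)
qed

lemma poly_eval_times:
  assumes "u \<in> V \<rightarrow> carrier R" "poly_bounded V L D P" "poly_bounded V L' D' Q"
  shows "poly_eval R u (poly_times P Q) = poly_eval R u P \<otimes> poly_eval R u Q"
  using assms(2)
proof (induction P)
  case Nil
  then show ?case
    using poly_eval_closed[OF assms(1,3)] by (simp add: poly_eval_def poly_times_def)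
next
  case (Cons m P)
  have P: "poly_bounded V L D P" and m: "set m \<subseteq> V"
    using Cons.prems by (auto simp: poly_bounded_def)
  have mQ: "poly_bounded V (1 * L') (length m + D') (map ((@) m) Q)"
    using poly_bounded_times[of V 1 "length m" "[m]" L' D' Q] m assms(3)
    by (auto simp: poly_times_def poly_bounded_def)
  have "poly_eval R u (poly_times (m # P) Q) =
      poly_eval R u (map ((@) m) Q) \<oplus> poly_eval R u (poly_times P Q)"
    using poly_eval_append[OF assms(1) mQ poly_bounded_times[OF P assms(3)]]
    by (simp add: poly_times_def)
  also have "\<dots> = (monom_eval R u m \<oplus> poly_eval R u P) \<otimes> poly_eval R u Q"
    using poly_eval_map_append[OF assms(1) m assms(3)] Cons.IH[OF P]
      monom_eval_closed[OF assms(1) m] poly_eval_closed[OF assms(1) P]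
      poly_eval_closed[OF assms(1,3)]
    by (simp add: l_distr)
  finally show ?case by (simp add: poly_eval_def)
qed

text \<open>Commutativity of multiplication absorbs the order inside a monomial, commutativity of
  addition the order of the monomials.\<close>

lemma poly_eval_mset_cong:
  assumes u: "u \<in> V \<rightarrow> carrier R" and P: "poly_bounded V L D P"
    and eq: "mset (map mset P) = mset (map mset Q)"
  shows "poly_eval R u P = poly_eval R u Q"
proof -
  \<comment> \<open>A function on multisets: one representative list is picked for each monomial,
    and commutativity makes the pick immaterial.\<close>
  define g where "g M = monom_eval R u (SOME m. mset m = M)" for M
  have g: "monom_eval R u m = g (mset m)" if "set m \<subseteq> V" for m
  proof -
    have "mset (SOME m'. mset m' = mset m) = mset m" by (rule someI) (rule refl)
    then show ?thesis
      unfolding g_def monom_eval_def using that u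
      by (intro mset_foldr_cong) (auto simp: comm_monoid_axioms)
  qed
  have Vs: "set_mset M \<subseteq> V" if M: "M \<in># mset (map mset P)" for M
    proof -
    obtain m where "m \<in> set P" "M = mset m" using M by auto
    then show ?thesis using poly_boundedD[OF P, of m] by simp
  qed
  have V: "set m \<subseteq> V" if "m \<in> set P \<union> set Q" for m
  proof -
    have "mset m \<in># mset (map mset P)"
      using that eq by (metis Un_iff image_eqI set_map set_mset_mset)
    then show ?thesis using Vs[of "mset m"] by simp
  qed
  have ev: "poly_eval R u S = foldr (\<oplus>) (map g (map mset S)) \<zero>" if "set S \<subseteq> set P \<union> set Q" for S
    unfolding poly_eval_def map_map comp_def using that V g
    by (intro arg_cong2[of _ _ _ _ "\<lambda>xs. foldr (\<oplus>) xs"] map_cong) auto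
  have cl: "g M \<in> carrier R" if M: "M \<in># mset (map mset P)" for M
  proof -
    obtain m where "m \<in> set P" "M = mset m" using M by auto
    then show ?thesis using V[of m] g[of m] monom_eval_closed[OF u, of m] by simp
  qed
  have "foldr (\<oplus>) (map g (map mset P)) \<zero> = foldr (\<oplus>) (map g (map mset Q)) \<zero>"
    using mset_foldr_cong[OF a_comm_monoid eq, of g] cl by (simp add: image_subset_iff)
  then show ?thesis using ev by simp
qed

end

section \<open>Products and sums of families of polynomials\<close>

text \<open>The order of quantifiers matters: one \<open>Q\<close> serves all commutative rings of
  the given type and all points, so fields of different characteristic share their polynomials.
  Lengths multiply and degrees add under \<open>poly_times\<close>.\<close>

lemma ex_poly_finprod:
  fixes p :: "'i \<Rightarrow> 'v list list"
  assumes "finite S" "\<And>i. i \<in> S \<Longrightarrow> poly_bounded V L D (p i)"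
  shows "\<exists>Q. poly_bounded V (L ^ card S) (D * card S) Q \<and>
    (\<forall>(R :: ('k, 'm) ring_scheme) u. cring R \<longrightarrow> u \<in> V \<rightarrow> carrier R \<longrightarrow>
       poly_eval R u Q = (\<Otimes>\<^bsub>R\<^esub>i\<in>S. poly_eval R u (p i)))"
  using assms
proof (induction S)
  case empty
  show ?case
  \<comment> \<open>The empty monomial alone denotes the constant 1.\<close>
  proof (intro exI[of _ "[[]]"] conjI allI impI)
    fix R :: "('k, 'm) ring_scheme" and u :: "'v \<Rightarrow> 'k"
    assume "cring R"
    then interpret cring R .
    show "poly_eval R u [[]] = (\<Otimes>\<^bsub>R\<^esub>i\<in>{}. poly_eval R u (p i))"
      by (simp add: poly_eval_def monom_eval_def)
  qed (auto simp: poly_bounded_def)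
next
  case (insert i S)
  then obtain Q where Q: "poly_bounded V (L ^ card S) (D * card S) Q"
    and ev: "\<And>(R :: ('k, 'm) ring_scheme) u. cring R \<Longrightarrow> u \<in> V \<rightarrow> carrier R \<Longrightarrow>
       poly_eval R u Q = (\<Otimes>\<^bsub>R\<^esub>i\<in>S. poly_eval R u (p i))"
    by auto
  show ?case
  proof (intro exI[of _ "poly_times (p i) Q"] conjI allI impI)
    show "poly_bounded V (L ^ card (insert i S)) (D * card (insert i S)) (poly_times (p i) Q)"
      using poly_bounded_times[OF _ Q, of L D "p i"] insert by simp
    fix R :: "('k, 'm) ring_scheme" and u :: "'v \<Rightarrow> 'k"
    assume R: "cring R" and u: "u \<in> V \<rightarrow> carrier R"
    then interpret cring R by simp
    have "poly_eval R u (p j) \<in> carrier R" if "j \<in> insert i S" for j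
      using poly_eval_closed[OF u] insert.prems that by blast
    then show "poly_eval R u (poly_times (p i) Q) =
        (\<Otimes>\<^bsub>R\<^esub>i\<in>insert i S. poly_eval R u (p i))"
      using insert.hyps poly_eval_times[OF u insert.prems Q] ev[OF R u] by simp
  qed
qed

text \<open>Addition is concatenation, so lengths add while the degree bound stays; again
  \<open>Q\<close> is chosen before the ring and the point.\<close>

lemma ex_poly_finsum:
  fixes p :: "'i \<Rightarrow> 'v list list"
  assumes "finite S" "\<And>i. i \<in> S \<Longrightarrow> poly_bounded V L D (p i)"
  shows "\<exists>Q. poly_bounded V (L * card S) D Q \<and>
    (\<forall>(R :: ('k, 'm) ring_scheme) u. cring R \<longrightarrow> u \<in> V \<rightarrow> carrier R \<longrightarrow>
       poly_eval R u Q = (\<Oplus>\<^bsub>R\<^esub>i\<in>S. poly_eval R u (p i)))"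
  using assms
proof (induction S)
  case empty
  show ?case
  proof (intro exI[of _ "[]"] conjI allI impI)
    fix R :: "('k, 'm) ring_scheme" and u :: "'v \<Rightarrow> 'k"
    assume "cring R"
    then interpret cring R .
    show "poly_eval R u [] = (\<Oplus>\<^bsub>R\<^esub>i\<in>{}. poly_eval R u (p i))"
      by (simp add: poly_eval_def)
  qed (auto simp: poly_bounded_def)
next
  case (insert i S)
  then obtain Q where Q: "poly_bounded V (L * card S) D Q"
    and ev: "\<And>(R :: ('k, 'm) ring_scheme) u. cring R \<Longrightarrow> u \<in> V \<rightarrow> carrier R \<Longrightarrow>
       poly_eval R u Q = (\<Oplus>\<^bsub>R\<^esub>i\<in>S. poly_eval R u (p i))"
    by auto
  show ?case
  proof (intro exI[of _ "p i @ Q"] conjI allI impI)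
    show "poly_bounded V (L * card (insert i S)) D (p i @ Q)"
      using poly_bounded_append[OF _ Q, of L "p i"] insert by simp
    fix R :: "('k, 'm) ring_scheme" and u :: "'v \<Rightarrow> 'k"
    assume R: "cring R" and u: "u \<in> V \<rightarrow> carrier R"
    then interpret cring R by simp
    have "poly_eval R u (p j) \<in> carrier R" if "j \<in> insert i S" for j
      using poly_eval_closed[OF u] insert.prems that by blast
    then show "poly_eval R u (p i @ Q) = (\<Oplus>\<^bsub>R\<^esub>i\<in>insert i S. poly_eval R u (p i))"
      using insert.hyps poly_eval_append[OF u insert.prems Q] ev[OF R u]
      by (simp add: finsum_insert Pi_def)
  qed
qed

section \<open>Counting multisets and zero patterns\<close>

text \<open>The multiplicities on \<open>A\<close>, each between 0 and \<open>a\<close>, determine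
  the multiset. It is applied to monomials as multisets of variables and to polynomials as multisets
  of monomials.\<close>

lemma card_bounded_multisets:
  assumes "finite A"
  shows "finite {N. set_mset N \<subseteq> A \<and> size N \<le> a}"
    and "card {N. set_mset N \<subseteq> A \<and> size N \<le> a} \<le> (a + 1) ^ card A"
proof -
  let ?M = "{N. set_mset N \<subseteq> A \<and> size N \<le> a}"
  let ?f = "\<lambda>N. restrict (count N) A"
  have inj: "inj_on ?f ?M"
  proof (rule inj_onI, rule multiset_eqI)
    fix N N' x assume *: "N \<in> ?M" "N' \<in> ?M" "?f N = ?f N'"
    show "count N x = count N' x"
    proof (cases "x \<in> A")
      case True
      then show ?thesis using fun_cong[OF *(3), of x] by simp
    next
      case False
      then have "x \<notin># N" "x \<notin># N'" using * by auto
      then show ?thesis by (simp add: not_in_iff)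
    qed
  qed
  have sub: "?f ` ?M \<subseteq> A \<rightarrow>\<^sub>E {0..a}"
    using order_trans[OF count_le_size] by (auto simp: PiE_def)
  have fin: "finite (A \<rightarrow>\<^sub>E {0..a})" using assms by (intro finite_PiE) auto
  show "finite ?M" using finite_imageD[OF finite_subset[OF sub fin] inj] .
  show "card ?M \<le> (a + 1) ^ card A"
    using card_inj_on_le[OF inj sub fin] assms by (simp add: card_PiE)
qed

text \<open>The sums of \<open>g\<^sub>S = \<Prod>i\<in>S. p i\<close> over the \<open>2 ^ card \<S>\<close> subfamilies of \<open>\<S>\<close> are pairwise distinct
  polynomials: at a point realising a minimal \<open>S\<close> in the symmetric difference of two subfamilies,
  every \<open>g\<^sub>T\<close> with \<open>\<not> T \<subseteq> S\<close> vanishes while \<open>g\<^sub>S\<close> does not.\<close>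

lemma zero_patterns_bound:
  fixes p :: "'i \<Rightarrow> 'v list list" and \<S> :: "'i set set"
  assumes V: "finite V" and I: "finite I"
    and p: "\<And>i. i \<in> I \<Longrightarrow> poly_bounded V L D (p i)" and L: "L \<ge> 1"
    and \<S>: "\<And>S. S \<in> \<S> \<Longrightarrow> \<exists>(R :: 'k ring) u. domain R \<and> u \<in> V \<rightarrow> carrier R \<and>
       S = {i \<in> I. poly_eval R u (p i) \<noteq> \<zero>\<^bsub>R\<^esub>}"
  shows "2 ^ card \<S> \<le> (L ^ card I * card \<S> + 1) ^ (D * card I + 1) ^ card V"
proof -
  have \<S>I: "S \<subseteq> I" if "S \<in> \<S>" for S using \<S>[OF that] by blast
  have fin\<S>: "finite \<S>" using I \<S>I by (meson Pow_iff finite_Pow_iff finite_subset subsetI)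
  let ?G = "\<lambda>S Q. poly_bounded V (L ^ card I) (D * card I) Q \<and>
    (\<forall>(R :: 'k ring) u. cring R \<longrightarrow> u \<in> V \<rightarrow> carrier R \<longrightarrow>
       poly_eval R u Q = (\<Otimes>\<^bsub>R\<^esub>i\<in>S. poly_eval R u (p i)))"
  have "\<exists>Q. ?G S Q" if S: "S \<in> \<S>" for S
  proof -
    have fS: "finite S" and c: "card S \<le> card I"
      using \<S>I[OF S] I by (auto intro: finite_subset card_mono)
    obtain Q where "poly_bounded V (L ^ card S) (D * card S) Q"
      and "\<forall>(R :: 'k ring) u. cring R \<longrightarrow> u \<in> V \<rightarrow> carrier R \<longrightarrow>
       poly_eval R u Q = (\<Otimes>\<^bsub>R\<^esub>i\<in>S. poly_eval R u (p i))"
      using ex_poly_finprod[OF fS, of V L D p, where 'k = 'k and 'm = unit] p \<S>I[OF S] by blast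
    moreover have "L ^ card S \<le> L ^ card I" "D * card S \<le> D * card I"
      using c L by (auto intro: power_increasing)
    ultimately show ?thesis using poly_bounded_mono by blast
  qed
  then have "\<forall>S\<in>\<S>. \<exists>Q. ?G S Q" by (intro ballI)
  from bchoice[OF this] obtain g where gG: "\<forall>S\<in>\<S>. ?G S (g S)" by (elim exE)
  then have g: "\<And>S. S \<in> \<S> \<Longrightarrow> poly_bounded V (L ^ card I) (D * card I) (g S)"
    and g_ev: "\<And>S (R :: 'k ring) u. S \<in> \<S> \<Longrightarrow> cring R \<Longrightarrow> u \<in> V \<rightarrow> carrier R \<Longrightarrow>
       poly_eval R u (g S) = (\<Otimes>\<^bsub>R\<^esub>i\<in>S. poly_eval R u (p i))"
    by blast+
  let ?H = "\<lambda>T Q. poly_bounded V (L ^ card I * card \<S>) (D * card I) Q \<and>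
    (\<forall>(R :: 'k ring) u. cring R \<longrightarrow> u \<in> V \<rightarrow> carrier R \<longrightarrow>
       poly_eval R u Q = (\<Oplus>\<^bsub>R\<^esub>S\<in>T. poly_eval R u (g S)))"
  have "\<exists>Q. ?H T Q" if T: "T \<in> Pow \<S>" for T
  proof -
    have fT: "finite T" and c: "card T \<le> card \<S>"
      using T fin\<S> by (auto intro: finite_subset card_mono)
    obtain Q where "poly_bounded V (L ^ card I * card T) (D * card I) Q"
      and "\<forall>(R :: 'k ring) u. cring R \<longrightarrow> u \<in> V \<rightarrow> carrier R \<longrightarrow>
       poly_eval R u Q = (\<Oplus>\<^bsub>R\<^esub>S\<in>T. poly_eval R u (g S))"
      using ex_poly_finsum[OF fT, of V "L ^ card I" "D * card I" g, where 'k = 'k and 'm = unit]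
        g T by blast
    moreover have "L ^ card I * card T \<le> L ^ card I * card \<S>" using c by simp
    ultimately show ?thesis using poly_bounded_mono by blast
  qed
  then have "\<forall>T\<in>Pow \<S>. \<exists>Q. ?H T Q" by (intro ballI)
  from bchoice[OF this] obtain h where hH: "\<forall>T\<in>Pow \<S>. ?H T (h T)" by (elim exE)
  then have h: "\<And>T. T \<in> Pow \<S> \<Longrightarrow> poly_bounded V (L ^ card I * card \<S>) (D * card I) (h T)"
    and h_ev: "\<And>T (R :: 'k ring) u. T \<in> Pow \<S> \<Longrightarrow> cring R \<Longrightarrow> u \<in> V \<rightarrow> carrier R \<Longrightarrow>
       poly_eval R u (h T) = (\<Oplus>\<^bsub>R\<^esub>S\<in>T. poly_eval R u (g S))"
    by blast+

  \<comment> \<open>Only the case of \<open>S\<close> in \<open>T\<close> but not in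
    \<open>T'\<close> is treated; \<open>inj\<close> gets the other by exchanging \<open>T\<close>
    and \<open>T'\<close>.\<close>
  have contra: False
    if T: "T \<in> Pow \<S>" "T' \<in> Pow \<S>" "mset (map mset (h T)) = mset (map mset (h T'))"
      and S: "S \<in> T" "S \<notin> T'"
      and min: "\<And>S'. S' \<in> T - T' \<union> (T' - T) \<Longrightarrow> \<not> S' \<subset> S" for T T' S
  proof -
    have S\<S>: "S \<in> \<S>" using S T by blast
    obtain R :: "'k ring" and u where R: "domain R" and u: "u \<in> V \<rightarrow> carrier R"
      and S_eq: "S = {i \<in> I. poly_eval R u (p i) \<noteq> \<zero>\<^bsub>R\<^esub>}"
      using \<S>[OF S\<S>] by blast
    interpret domain R by fact
    let ?e = "\<lambda>S. poly_eval R u (g S)"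
    have p_in: "poly_eval R u (p i) \<in> carrier R" if "i \<in> I" for i
      using poly_eval_closed[OF u p[OF that]] .
    have e_in: "?e S' \<in> carrier R" if "S' \<in> \<S>" for S'
      using poly_eval_closed[OF u g[OF that]] .
    have e0: "?e S' = \<zero>\<^bsub>R\<^esub>" if S': "S' \<in> \<S>" "\<not> S' \<subseteq> S" for S'
    proof -
      \<comment> \<open>An index of \<open>S'\<close> outside \<open>S\<close> gives a factor that
        vanishes at the point realising \<open>S\<close>.\<close>
      obtain i where i: "i \<in> S'" "i \<in> I" "poly_eval R u (p i) = \<zero>\<^bsub>R\<^esub>"
        using S' \<S>I S_eq by blast
      have "finite S'" using S'(1) \<S>I I finite_subset by blast
      then have "(\<Otimes>\<^bsub>R\<^esub>i\<in>insert i (S' - {i}). poly_eval R u (p i)) =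
          poly_eval R u (p i) \<otimes>\<^bsub>R\<^esub> (\<Otimes>\<^bsub>R\<^esub>i\<in>S' - {i}. poly_eval R u (p i))"
        using S'(1) \<S>I i(2) p_in by (intro finprod_insert) auto
      also have "\<dots> = \<zero>\<^bsub>R\<^esub>"
        unfolding i(3) using S'(1) \<S>I p_in by (intro l_null finprod_closed) auto
      finally show ?thesis
        using g_ev[OF S'(1) cring_axioms u] i(1) by (simp add: insert_absorb)
    qed
    have fT: "finite T" "finite T'" using T fin\<S> by (auto intro: finite_subset)
    \<comment> \<open>By minimality, no proper subset of \<open>S\<close> lies in the symmetric
      difference.\<close>
    have iff: "S' \<in> T \<longleftrightarrow> S' \<in> T'" if "S' \<subset> S" for S'
      using min[of S'] that by blast
    have eq: "{S' \<in> T. S' \<subset> S} = {S' \<in> T'. S' \<subset> S}" using iff by blast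
    have cut: "(\<Oplus>\<^bsub>R\<^esub>S\<in>U. ?e S) = (\<Oplus>\<^bsub>R\<^esub>S'\<in>{S' \<in> U. S' \<subseteq> S}. ?e S')" if "U \<in> Pow \<S>" for U
      using that fin\<S> e0 e_in
      by (intro add.finprod_mono_neutral_cong_right) (auto intro: finite_subset)
    have "(\<Oplus>\<^bsub>R\<^esub>S'\<in>{S' \<in> T. S' \<subseteq> S}. ?e S') = (\<Oplus>\<^bsub>R\<^esub>S'\<in>insert S {S' \<in> T. S' \<subset> S}. ?e S')"
      using S by (intro arg_cong[where f = "finsum R ?e"]) blast
    also have "\<dots> = ?e S \<oplus>\<^bsub>R\<^esub> (\<Oplus>\<^bsub>R\<^esub>S'\<in>{S' \<in> T. S' \<subset> S}. ?e S')"
      using fT(1) T(1) e_in[OF S\<S>] by (intro finsum_insert) (auto intro: e_in)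
    also have "{S' \<in> T. S' \<subset> S} = {S' \<in> T'. S' \<subseteq> S}" using eq S(2) by blast
    \<comment> \<open>The two values differ by exactly \<open>?e S\<close>, yet the polynomials
      agree, so \<open>?e S\<close> is forced to be zero.\<close>
    finally have "?e S \<oplus>\<^bsub>R\<^esub> poly_eval R u (h T') = poly_eval R u (h T)"
      using cut T h_ev[OF _ cring_axioms u] by simp
    moreover have "poly_eval R u (h T) = poly_eval R u (h T')"
      using poly_eval_mset_cong[OF u h[OF T(1)] T(3)] .
    moreover have "poly_eval R u (h T') \<in> carrier R" using poly_eval_closed[OF u h[OF T(2)]] .
    ultimately have "?e S = \<zero>\<^bsub>R\<^esub>" using e_in[OF S\<S>] by (metis add.r_cancel_one)
    moreover have "?e S \<noteq> \<zero>\<^bsub>R\<^esub>"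
    proof -
      \<comment> \<open>Here the absence of zero divisors enters: all factors indexed by
        \<open>S\<close> are nonzero at \<open>u\<close>.\<close>
      have nz: "(\<Otimes>\<^bsub>R\<^esub>i\<in>J. poly_eval R u (p i)) \<noteq> \<zero>\<^bsub>R\<^esub>" if "finite J" "J \<subseteq> S" for J
        using that
      proof (induction J)
        case (insert i J)
        have "\<And>j. j \<in> insert i J \<Longrightarrow> poly_eval R u (p j) \<in> carrier R" 
          "poly_eval R u (p i) \<noteq> \<zero>\<^bsub>R\<^esub>"
          using insert.prems S_eq p_in by auto
        then show ?case using insert by (subst finprod_insert) (auto simp: integral_iff Pi_def)
      qed simp
      have "finite S" using \<S>I[OF S\<S>] I finite_subset by blast
      then show ?thesis using nz[of S] g_ev[OF S\<S> cring_axioms u] by simp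
    qed
    ultimately show False by blast
  qed
  have inj: "inj_on (\<lambda>T. mset (map mset (h T))) (Pow \<S>)"
  proof (rule inj_onI, rule ccontr)
    fix T T' assume T: "T \<in> Pow \<S>" "T' \<in> Pow \<S>" "T \<noteq> T'"
      "mset (map mset (h T)) = mset (map mset (h T'))"
    let ?D = "T - T' \<union> (T' - T)"
    have "finite ?D" "?D \<noteq> {}" using T fin\<S> by (auto intro: finite_subset)
    then obtain S where S: "S \<in> ?D" "\<And>S'. S' \<in> ?D \<Longrightarrow> \<not> S' \<subset> S"
      by (metis finite_has_minimal psubset_eq)
    then show False
      using contra[of T T' S] contra[of T' T S] T by (metis DiffE Un_commute UnE)
  qed

  \<comment> \<open>\<open>A\<close> collects the possible monomials and \<open>?B\<close> the
    possible polynomials, both up to order.\<close>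
  define A where "A = {m :: 'v multiset. set_mset m \<subseteq> V \<and> size m \<le> D * card I}"
  let ?B = "{N. set_mset N \<subseteq> A \<and> size N \<le> L ^ card I * card \<S>}"
  have A: "finite A" "card A \<le> (D * card I + 1) ^ card V"
    unfolding A_def using card_bounded_multisets[OF V] by auto
  have "(\<lambda>T. mset (map mset (h T))) ` Pow \<S> \<subseteq> ?B"
  proof (rule image_subsetI)
    fix T assume "T \<in> Pow \<S>"
    from h[OF this] show "mset (map mset (h T)) \<in> ?B"
      by (simp add: poly_bounded_def A_def image_subset_iff)
  qed
  then have "card (Pow \<S>) \<le> card ?B"
    by (rule card_inj_on_le[OF inj]) (rule card_bounded_multisets(1)[OF A(1)])
  also have "\<dots> \<le> (L ^ card I * card \<S> + 1) ^ card A"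
    using card_bounded_multisets[OF A(1)] by blast
  also have "\<dots> \<le> (L ^ card I * card \<S> + 1) ^ (D * card I + 1) ^ card V"
    using A(2) by (intro power_increasing) auto
  finally show ?thesis using fin\<S> by (simp add: card_Pow)
qed

section \<open>Counting representable matroids\<close>

text \<open>The variable \<open>Some (i, e)\<close> stands for the matrix entry \<open>A i e\<close>; \<open>None\<close> is evaluated at \<open>-1\<close> and
  carries the signs of the permutations, so that no negative coefficients are needed.\<close>

definition det_poly :: "nat \<Rightarrow> 'e::linorder set \<Rightarrow> (nat \<times> 'e) option list list" where
  "det_poly r B =
     map (\<lambda>p. (if evenperm p then [] else [None]) @
            map (\<lambda>i. Some (i, sorted_list_of_set B ! (p i - 1))) [1..<Suc r])
       (SOME ps. distinct ps \<and> set ps = {p. p permutes {1..r}})"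

text \<open>The Leibniz expansion has \<open>fact r\<close> terms, each with \<open>r\<close>
  entries and possibly the sign variable, hence degree at most \<open>r + 1\<close>.\<close>

lemma poly_eval_det_poly:
  assumes B: "finite E" "B \<subseteq> E" "card B = r"
  shows "poly_bounded (insert None (Some ` ({1..r} \<times> E))) (fact r) (r + 1) (det_poly r B)"
    and "cring R \<Longrightarrow> u \<in> insert None (Some ` ({1..r} \<times> E)) \<rightarrow> carrier R \<Longrightarrow> u None = \<ominus>\<^bsub>R\<^esub> \<one>\<^bsub>R\<^esub> \<Longrightarrow>
      poly_eval R u (det_poly r B) = ring_det R r (column_submatrix (\<lambda>i e. u (Some (i, e))) B)"
proof -
  let ?V = "insert None (Some ` ({1..r} \<times> E))"
  define ps where "ps = (SOME ps. distinct ps \<and> set ps = {p. p permutes {1..r}})"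
  have "finite {p. p permutes {1..r}}" by (rule finite_permutations) simp
  then have "\<exists>ps. distinct ps \<and> set ps = {p. p permutes {1..r}}"
    using finite_distinct_list by blast
  then have ps: "distinct ps" "set ps = {p. p permutes {1..r}}"
    unfolding ps_def by (metis (mono_tags, lifting) someI_ex)+
  have len: "length ps = fact r"
    using ps card_permutations[of "{1..r}" r] by (simp flip: distinct_card)
  define c where "c p i = sorted_list_of_set B ! (p i - 1)" for p :: "nat \<Rightarrow> nat" and i
  define mon where "mon p = (if evenperm p then [] else [None]) @
      map (\<lambda>i. Some (i, c p i)) [1..<Suc r]" for p :: "nat \<Rightarrow> nat"
  have det: "det_poly r B = map mon ps"
    by (simp only: det_poly_def mon_def[abs_def] c_def ps_def)
  have cE: "c p i \<in> E" if p: "p permutes {1..r}" and i: "i \<in> {1..r}" for p i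
  proof -
    have "p i \<in> {1..r}" using permutes_in_image[OF p] i by simp
    then have "c p i \<in> set (sorted_list_of_set B)"
      unfolding c_def using B by (intro nth_mem) auto
    moreover have "finite B" using B finite_subset by blast
    ultimately show ?thesis using B by auto
  qed
  have mon_V: "set (mon p) \<subseteq> ?V" if "p permutes {1..r}" for p
    using cE[OF that] by (auto simp: mon_def)
  have mon_len: "length (mon p) \<le> r + 1" for p by (simp add: mon_def)
  show "poly_bounded ?V (fact r) (r + 1) (det_poly r B)"
    unfolding poly_bounded_def det using ps(2) mon_V mon_len by (simp add: len)
  assume "cring R" and u: "u \<in> ?V \<rightarrow> carrier R" and u_None: "u None = \<ominus>\<^bsub>R\<^esub> \<one>\<^bsub>R\<^esub>"
  then interpret cring R by simp
  let ?M = "column_submatrix (\<lambda>i e. u (Some (i, e))) B"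
  let ?t = "\<lambda>p. if evenperm p then (\<Otimes>\<^bsub>R\<^esub>i\<in>{1..r}. ?M i (p i))
        else \<ominus>\<^bsub>R\<^esub> (\<Otimes>\<^bsub>R\<^esub>i\<in>{1..r}. ?M i (p i))"
  have mon: "monom_eval R u (mon p) = ?t p" if p: "p permutes {1..r}" for p
  proof -
    let ?m = "map (\<lambda>i. Some (i, c p i)) [1..<Suc r]"
    have cl: "u (Some (i, c p i)) \<in> carrier R" if "i \<in> {1..r}" for i
      using u cE[OF p that] that by auto
    have "monom_eval R u ?m = (\<Otimes>\<^bsub>R\<^esub>i\<in>set [1..<Suc r]. u (Some (i, c p i)))"
      unfolding monom_eval_def map_map comp_def using cl
      by (subst finprod_set_eq_foldr) auto
    also have "set [1..<Suc r] = {1..r}" by auto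
    finally have m: "monom_eval R u ?m = (\<Otimes>\<^bsub>R\<^esub>i\<in>{1..r}. ?M i (p i))"
      by (simp add: column_submatrix_def c_def)
    have "monom_eval R u ?m \<in> carrier R"
      using u mon_V[OF p] by (intro monom_eval_closed[OF u]) (auto simp: mon_def)
    then show ?thesis
      unfolding m[symmetric] by (simp add: mon_def monom_eval_def u_None l_minus)
  qed
  have t: "?t p \<in> carrier R" if "p permutes {1..r}" for p
    using monom_eval_closed[OF u mon_V[OF that]] mon[OF that] by simp
  have "poly_eval R u (det_poly r B) = foldr (\<oplus>\<^bsub>R\<^esub>) (map ?t ps) \<zero>\<^bsub>R\<^esub>"
    unfolding poly_eval_def det map_map comp_def using mon ps(2)
    by (intro arg_cong2[of _ _ _ _ "\<lambda>xs. foldr (\<oplus>\<^bsub>R\<^esub>) xs"] map_cong) auto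
  also have "\<dots> = (\<Oplus>\<^bsub>R\<^esub>p\<in>set ps. ?t p)"
  proof -
    have "?t ` set ps \<subseteq> carrier R" using t unfolding ps(2) by blast
    from add.finprod_set_eq_foldr[OF ps(1) this] show ?thesis by simp
  qed
  finally show "poly_eval R u (det_poly r B) = ring_det R r ?M"
    unfolding ps(2) ring_det_def .
qed

section \<open>Upper bounds for representable matroids\<close>

text \<open>\<open>zero_patterns_bound\<close> is applied to the \<open>n choose r\<close> maximal
  minors in \<open>r * n\<close> entry variables and the sign variable: the bases are the column
  sets whose minors do not vanish.\<close>

lemma card_representable_of_rank:
  fixes n r :: nat and k :: "'k itself"
  defines "\<S> \<equiv> {\<B>. matroid {1..n} \<B> \<and> representable k {1..n} \<B> \<and> matroid_rank \<B> = r}"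
  shows "2 ^ card \<S> \<le>
    (fact r ^ (n choose r) * card \<S> + 1) ^ ((r + 1) * (n choose r) + 1) ^ (r * n + 1)"
proof -
  define I where "I = {B. B \<subseteq> {1..n} \<and> card B = r}"
  define V :: "(nat \<times> nat) option set" where "V = insert None (Some ` ({1..r} \<times> {1..n}))"
  have I: "finite I" "card I = n choose r"
    using n_subsets[of "{1..n}" r] finite_subset[of I "Pow {1..n}"] by (auto simp: I_def)
  have "card (Some ` ({1..r} \<times> {1..n})) = r * n"
    by (subst card_image) auto
  then have V: "finite V" "card V = r * n + 1"
    by (auto simp: V_def card_insert_if)
  have p: "poly_bounded V (fact r) (r + 1) (det_poly r B)" if "B \<in> I" for B
    unfolding V_def using that by (intro poly_eval_det_poly) (auto simp: I_def)
  have "\<exists>(R :: 'k ring) u. domain R \<and> u \<in> V \<rightarrow> carrier R \<and>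
       \<B> = {B \<in> I. poly_eval R u (det_poly r B) \<noteq> \<zero>\<^bsub>R\<^esub>}" if \<B>: "\<B> \<in> \<S>" for \<B>
  proof -
    have r: "matroid_rank \<B> = r" using \<B> by (simp add: \<S>_def)
    obtain F :: "'k ring" and A where F: "field F"
      and A: "\<forall>i\<in>{1..r}. \<forall>e\<in>{1..n}. A i e \<in> carrier F"
      and eq: "\<B> = {B. B \<subseteq> {1..n} \<and> card B = r \<and> ring_det F r (column_submatrix A B) \<noteq> \<zero>\<^bsub>F\<^esub>}"
      using \<B> unfolding \<S>_def representable_def representable_over_def by auto
    interpret field F by fact
    define u where "u = case_option (\<ominus>\<^bsub>F\<^esub> \<one>\<^bsub>F\<^esub>) (case_prod A)"
    have u: "u \<in> V \<rightarrow> carrier F" using A by (auto simp: u_def V_def)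
    have "poly_eval F u (det_poly r B) = ring_det F r (column_submatrix A B)" if "B \<in> I" for B
      using poly_eval_det_poly(2)[of "{1..n}" B r F u] that u
      by (simp add: I_def V_def u_def cring_axioms)
    then have "\<B> = {B \<in> I. poly_eval F u (det_poly r B) \<noteq> \<zero>\<^bsub>F\<^esub>}"
      unfolding eq by (auto simp: I_def)
    then show ?thesis using u domain_axioms by blast
  qed
  from zero_patterns_bound[OF V(1) I(1) p fact_ge_1 this]
  show ?thesis unfolding V(2) I(2) .
qed

text \<open>\<open>card_representable_of_rank\<close> has the count on both sides. A crude bound on
  the right suffices, since taking logarithms to base 2 then leaves an exponent cubic in
  \<open>n\<close>. The factor \<open>n + 1\<close> counts the ranks from 0 to
  \<open>n\<close>.\<close>

lemma num_representable_matroids_le: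
  "num_representable_matroids k n \<le>
     (n + 1) * ((n\<^sup>2 + 2) * 2 ^ (n + (2 * n + 1) * (n\<^sup>2 + 1)))"
proof -
  define \<S> where
    "\<S> r = {\<B>. matroid {1..n} \<B> \<and> representable k {1..n} \<B> \<and> matroid_rank \<B> = r}" for r
  have bound: "card (\<S> r) \<le> (n\<^sup>2 + 2) * 2 ^ (n + (2 * n + 1) * (n\<^sup>2 + 1))" if r: "r \<le> n" for r
  proof -
    let ?N = "n choose r" and ?k = "card (\<S> r)"
    have n2: "n < 2 ^ n" by (rule less_exp)
    have N: "?N \<le> 2 ^ n"
      using choose_row_sum[of n] member_le_sum[of r "{..n}" "\<lambda>k. n choose k"] r by simp
    have "fact r \<le> (fact n :: nat)" using r by (rule fact_mono)
    also have "\<dots> \<le> of_nat (n ^ n)" by (rule fact_le_power)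
    also have "\<dots> \<le> (2 ^ n) ^ n" using n2 by (simp add: power_mono less_imp_le)
    also have "\<dots> = 2 ^ n\<^sup>2" by (simp add: power2_eq_square flip: power_mult)
    finally have "fact r ^ ?N \<le> ((2 :: nat) ^ n\<^sup>2) ^ 2 ^ n"
      using N by (meson one_le_numeral one_le_power order_trans power_increasing power_mono zero_le)
    \<comment> \<open>The crude bound: a matroid of rank \<open>r\<close> is a family of
      \<open>r\<close>-subsets, of which there are at most \<open>2 ^ n\<close>.\<close>
    moreover have "?k \<le> 2 ^ 2 ^ n"
    proof -
      have sub: "\<S> r \<subseteq> Pow {B. B \<subseteq> {1..n} \<and> card B = r}"
        using card_basis[of "{1..n}"] by (auto simp: \<S>_def matroid_def)
      have "finite {B. B \<subseteq> {1..n} \<and> card B = r}"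
        by (rule finite_subset[of _ "Pow {1..n}"]) auto
      then have "?k \<le> 2 ^ card {B. B \<subseteq> {1..n} \<and> card B = r}"
        using card_mono[OF _ sub] by (simp add: card_Pow)
      also have "\<dots> \<le> 2 ^ 2 ^ n"
        using N n_subsets[of "{1..n}" r] by (intro power_increasing) auto
      finally show ?thesis .
    qed
    ultimately have "fact r ^ ?N * ?k \<le> 2 ^ (n\<^sup>2 * 2 ^ n) * 2 ^ 2 ^ n"
      by (intro mult_le_mono) (simp_all add: power_mult)
    also have "\<dots> = 2 ^ ((n\<^sup>2 + 1) * 2 ^ n)" by (simp add: power_add algebra_simps)
    finally have "fact r ^ ?N * ?k + 1 \<le> 2 ^ ((n\<^sup>2 + 1) * 2 ^ n) + 2 ^ ((n\<^sup>2 + 1) * 2 ^ n)"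
      by (intro add_mono) auto
    also have "\<dots> = 2 ^ ((n\<^sup>2 + 1) * 2 ^ n + 1)" by simp
    also have "\<dots> \<le> 2 ^ ((n\<^sup>2 + 2) * 2 ^ n)" by (intro power_increasing) (auto simp: algebra_simps)
    finally have base: "fact r ^ ?N * ?k + 1 \<le> 2 ^ ((n\<^sup>2 + 2) * 2 ^ n)" .

    have "(r + 1) * ?N \<le> 2 ^ n * 2 ^ n"
      using N r n2 by (intro mult_le_mono) linarith+
    also have "\<dots> = 2 ^ (2 * n)" by (simp add: mult_2 flip: power_add)
    finally have "(r + 1) * ?N + 1 \<le> 2 ^ (2 * n) + 2 ^ (2 * n)" by (intro add_mono) auto
    also have "\<dots> = 2 ^ (2 * n + 1)" by simp
    finally have "((r + 1) * ?N + 1) ^ (r * n + 1) \<le> (2 ^ (2 * n + 1)) ^ (r * n + 1)"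
      by (rule power_mono) simp
    also have "\<dots> \<le> (2 ^ (2 * n + 1)) ^ (n\<^sup>2 + 1)"
      using r by (intro power_increasing) (auto simp: power2_eq_square)
    also have "\<dots> = 2 ^ ((2 * n + 1) * (n\<^sup>2 + 1))" by (simp only: power_mult)
    finally have ex: "((r + 1) * ?N + 1) ^ (r * n + 1) \<le> 2 ^ ((2 * n + 1) * (n\<^sup>2 + 1))" .

    have "2 ^ ?k \<le> (fact r ^ ?N * ?k + 1) ^ ((r + 1) * ?N + 1) ^ (r * n + 1)"
      unfolding \<S>_def by (rule card_representable_of_rank)
    also have "\<dots> \<le> (2 ^ ((n\<^sup>2 + 2) * 2 ^ n)) ^ ((r + 1) * ?N + 1) ^ (r * n + 1)"
      using base by (rule power_mono) simp
    also have "\<dots> \<le> (2 ^ ((n\<^sup>2 + 2) * 2 ^ n)) ^ 2 ^ ((2 * n + 1) * (n\<^sup>2 + 1))"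
      using ex by (rule power_increasing) simp
    also have "\<dots> = 2 ^ ((n\<^sup>2 + 2) * 2 ^ (n + (2 * n + 1) * (n\<^sup>2 + 1)))"
      by (simp only: power_add power_mult[symmetric] mult.assoc)
    finally show ?thesis by (rule power_le_imp_le_exp[rotated]) simp
  qed
  have "matroid_rank \<B> \<le> n" if \<B>: "matroid {1..n} \<B>" for \<B>
  proof -
    obtain B where B: "B \<in> \<B>" "B \<subseteq> {1..n}" using \<B> by (auto simp: matroid_def)
    then show ?thesis using card_basis[OF \<B> B(1)] card_mono[OF _ B(2)] by simp
  qed
  then have "{\<B>. matroid {1..n} \<B> \<and> representable k {1..n} \<B>} = (\<Union>r\<le>n. \<S> r)"
    by (auto simp: \<S>_def)
  then have "num_representable_matroids k n \<le> (\<Sum>r\<le>n. card (\<S> r))"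
    unfolding num_representable_matroids_def by (simp add: card_UN_le)
  also have "\<dots> \<le> (\<Sum>r\<le>n. (n\<^sup>2 + 2) * 2 ^ (n + (2 * n + 1) * (n\<^sup>2 + 1)))"
    using bound by (intro sum_mono) auto
  finally show ?thesis by simp
qed

section \<open>Sparse paving matroids\<close>

text \<open>By \<open>stable\<close>, distinct members of \<open>U\<close> never share
  \<open>r - 1\<close> elements. If \<open>B\<close> and \<open>B'\<close> differ in one element,
  the exchange yields \<open>B'\<close> itself. Otherwise two choices of \<open>f\<close> yield two
  sets sharing \<open>r - 1\<close> elements, and at most one of them is in
  \<open>U\<close>.\<close>

lemma matroid_delete_stable:
  assumes r: "0 < r" "r < n"
    and U: "\<And>B. B \<in> U \<Longrightarrow> B \<subseteq> {1..n} \<and> card B = r"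
    and stable: "\<And>B x y. x \<notin> B \<Longrightarrow> y \<notin> B \<Longrightarrow> insert x B \<in> U \<Longrightarrow> insert y B \<in> U \<Longrightarrow> x = y"
  shows "matroid {1..n} ({B. B \<subseteq> {1..n} \<and> card B = r} - U)"
  unfolding matroid_def
proof (intro conjI ballI)
  let ?B = "{B. B \<subseteq> {1..n} \<and> card B = r} - U"
  show "finite {1..n}" by simp
  show "?B \<noteq> {}"
  proof -
    \<comment> \<open>Two \<open>r\<close>-subsets of \<open>[n]\<close> sharing the
      \<open>r - 1\<close> elements of \<open>Z\<close>: at least one survives the deletion of
      \<open>U\<close>.\<close>
    define Z where "Z = {1..<r}"
    have "insert r Z \<in> ?B \<or> insert (r + 1) Z \<in> ?B"
      using stable[of r Z "r + 1"] r by (auto simp: Z_def)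
    then show ?thesis by blast
  qed
  show "B \<subseteq> {1..n}" if "B \<in> ?B" for B using that by blast
  fix B B' e assume B: "B \<in> ?B" and B': "B' \<in> ?B" and e: "e \<in> B' - B"
  have fin: "finite B" "finite B'" using B B' by (auto intro: finite_subset)
  have eq: "card (B - B') = card (B' - B)"
    using fin B B' card_Diff_subset_Int[of B B'] card_Diff_subset_Int[of B' B]
    by (simp add: Int_commute)
  show "\<exists>f\<in>B - B'. B \<union> {e} - {f} \<in> ?B"
  proof (cases "card (B - B') = 1")
    case True
    then obtain f e' where f: "B - B' = {f}" "B' - B = {e'}"
      using eq by (metis card_1_singletonE)
    then have "B' - B = {e}" using e by simp
    moreover have "B \<union> (B' - B) - (B - B') = B'" by blast
    ultimately have "B \<union> {e} - {f} = B'" using f(1) by simp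
    then have "B \<union> {e} - {f} \<in> ?B" using B' by simp
    then show ?thesis using f(1) by simp
  next
    case False
    have "B' - B \<noteq> {}" "finite (B' - B)" using e fin by blast+
    then have "card (B - B') \<noteq> 0" unfolding eq by simp
    then obtain f where f: "f \<in> B - B'" by (metis card.empty ex_in_conv)
    obtain f' where f': "f' \<in> B - B'" "f' \<noteq> f"
    proof -
      have "B - B' \<noteq> {f}" using False by auto
      then show ?thesis using that f by blast
    qed
    have card: "card (B \<union> {e} - {g}) = r" if "g \<in> B" for g
    proof -
      have "card (insert e B) = Suc r" using e fin(1) B by simp
      then show ?thesis using that fin(1) by (simp add: card_Diff_singleton)
    qed
    let ?Z = "B \<union> {e} - {f, f'}"
    have "B \<union> {e} - {f} = insert f' ?Z" "B \<union> {e} - {f'} = insert f ?Z"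
      using f f' e by auto
    moreover have "\<not> (insert f' ?Z \<in> U \<and> insert f ?Z \<in> U)"
      using stable[of f' ?Z f] f'(2) by blast
    ultimately have "B \<union> {e} - {f} \<notin> U \<or> B \<union> {e} - {f'} \<notin> U" by metis
    moreover have "B \<union> {e} - {g} \<subseteq> {1..n} \<and> card (B \<union> {e} - {g}) = r" if "g \<in> B - B'" for g
      using B B' e card[of g] that by blast
    ultimately have "B \<union> {e} - {f} \<in> ?B \<or> B \<union> {e} - {f'} \<in> ?B" using f f'(1) by simp
    then show ?thesis using f f'(1) by blast
  qed
qed

section \<open>Lower bounds for all matroids\<close>

text \<open>If two members share \<open>r - 1\<close> elements, equal sums modulo \<open>n\<close>
  force their remaining elements to be congruent, hence equal in \<open>[n]\<close>. So every
  subfamily of the class can be deleted, and different subfamilies leave different matroids.\<close>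

lemma num_matroids_ge_residue_class:
  assumes r: "0 < r" "r < n"
  shows "2 ^ card {B. B \<subseteq> {1..n} \<and> card B = r \<and> \<Sum>B mod n = j} \<le> num_matroids n"
proof -
  let ?C = "{B. B \<subseteq> {1..n} \<and> card B = r \<and> \<Sum>B mod n = j}"
  let ?A = "{B. B \<subseteq> {1..n} \<and> card B = r}"
  have fin: "finite ?C" by (rule finite_subset[of _ "Pow {1..n}"]) auto
  have "matroid {1..n} (?A - U)" if U: "U \<subseteq> ?C" for U
  proof (rule matroid_delete_stable[OF r])
    show "B \<subseteq> {1..n} \<and> card B = r" if "B \<in> U" for B using that U by blast
    fix B x y assume xy: "x \<notin> B" "y \<notin> B" "insert x B \<in> U" "insert y B \<in> U"
    have xB: "insert x B \<in> ?C" "insert y B \<in> ?C" using xy U by blast+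
    then have "finite B" by (auto intro: finite_subset)
    then have "(\<Sum>B + x) mod n = (\<Sum>B + y) mod n"
      using xB xy by (simp add: add.commute)
    then have "x mod n = y mod n"
      using cong_add_lcancel_nat by (auto simp: Cong.cong_def)
    moreover have "1 \<le> x" "x \<le> n" "1 \<le> y" "y \<le> n" using xB by auto
    \<comment> \<open>The element \<open>n\<close> is split off because its residue is 0; smaller
      ones are their own residues.\<close>
    ultimately show "x = y"
      by (cases "x = n"; cases "y = n") auto
  qed
  moreover have "inj_on (\<lambda>U. ?A - U) (Pow ?C)"
    by (rule inj_onI) blast
  moreover have "finite {\<B>. matroid {1..n} \<B>}"
    by (rule finite_subset[of _ "Pow (Pow {1..n})"]) (auto simp: matroid_def)
  ultimately have "card (Pow ?C) \<le> card {\<B>. matroid {1..n} \<B>}"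
    by (intro card_inj_on_le[of "\<lambda>U. ?A - U"]) auto
  then show ?thesis using fin by (simp add: card_Pow num_matroids_def)
qed

text \<open>Averaging twice: the middle binomial coefficient is at least
  \<open>2 ^ n / (n + 1)\<close>, and some residue class holds at least the fraction
  \<open>1 / n\<close> of the \<open>r\<close>-subsets.\<close>

lemma num_matroids_ge:
  assumes n: "n \<ge> 2"
  shows "2 powr (2 ^ n / (real n * (real n + 1))) \<le> real (num_matroids n)"
proof -
  define r where "r = n div 2"
  have r: "0 < r" "r < n" using n by (auto simp: r_def)
  let ?A = "{B. B \<subseteq> {1..n} \<and> card B = r}"
  let ?C = "\<lambda>j. {B. B \<subseteq> {1..n} \<and> card B = r \<and> \<Sum>B mod n = j}"
  have fin: "finite (?C j)" for j by (rule finite_subset[of _ "Pow {1..n}"]) auto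
  have "2 ^ n = (\<Sum>k\<le>n. n choose k)" by (rule choose_row_sum[symmetric])
  also have "\<dots> \<le> (\<Sum>k\<le>n. n choose r)"
    unfolding r_def by (intro sum_mono binomial_maximum)
  finally have row: "2 ^ n \<le> (n + 1) * (n choose r)" by simp
  \<comment> \<open>Pigeonhole over the \<open>n\<close> residues.\<close>
  obtain j where j: "n choose r \<le> n * card (?C j)"
  proof (rule ccontr)
    assume "\<not> thesis"
    then have less: "n * card (?C j) < n choose r" for j using that by (meson not_le)
    have "n choose r = card ?A" using n_subsets[of "{1..n}" r] by simp
    also have "?A = (\<Union>j<n. ?C j)" using r by auto
    also have "card \<dots> \<le> (\<Sum>j<n. card (?C j))" by (rule card_UN_le) simp
    finally have "n * (n choose r) \<le> (\<Sum>j<n. n * card (?C j))"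
      by (simp add: sum_distrib_left[symmetric])
    also have "\<dots> < (\<Sum>j<n. n choose r)" using n less by (intro sum_strict_mono) (auto simp: lessThan_empty_iff)
    finally show False by simp
  qed
  have "2 ^ n \<le> (n + 1) * (n * card (?C j))" using row j mult_le_mono2 order_trans by blast
  then have "real (2 ^ n) \<le> real ((n + 1) * (n * card (?C j)))" by (rule of_nat_mono)
  then have "2 ^ n / (real n * (real n + 1)) \<le> real (card (?C j))"
    using n by (subst pos_divide_le_eq) (simp_all add: algebra_simps add_pos_pos)
  then have "2 powr (2 ^ n / (real n * (real n + 1))) \<le> 2 powr real (card (?C j))"
    by (rule powr_mono) simp
  also have "\<dots> = real (2 ^ card (?C j))" by (simp add: powr_realpow)
  also have "\<dots> \<le> real (num_matroids n)"
    using num_matroids_ge_residue_class[OF r] by (rule of_nat_mono)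
  finally show ?thesis .
qed

section \<open>The proportion of representable matroids\<close>

text \<open>The numerator is 2 to a cubic exponent, up to a polynomial factor, while the denominator
  is at least 2 to the exponent \<open>2 ^ n / (n * (n + 1))\<close>. For infinite
  \<open>'k\<close>, \<open>representable_over_imp_representable\<close> shows that all fields are
  covered.\<close>

theorem mainTheorem2:
  shows "(\<lambda>n. real (num_representable_matroids TYPE('k) n) / real (num_matroids n)) \<longlonglongrightarrow> 0"
proof -
  let ?g = "\<lambda>n::nat. ((real n + 1) * ((real n ^ 2 + 2) * 2 powr (real n + (2 * real n + 1) * (real n ^ 2 + 1)))) /
      2 powr (2 ^ n / (real n * (real n + 1)))"
  have lim: "?g \<longlonglongrightarrow> 0" by real_asymp
  have lower: "\<forall>\<^sub>F n in sequentially. 0 \<le> real (num_representable_matroids TYPE('k) n) / real (num_matroids n)"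
    by simp
  have upper: "\<forall>\<^sub>F n in sequentially.
      real (num_representable_matroids TYPE('k) n) / real (num_matroids n) \<le> ?g n"
    using eventually_ge_at_top[of 2]
  proof eventually_elim
    case (elim n)
    have "real (num_representable_matroids TYPE('k) n) \<le>
        real ((n + 1) * ((n\<^sup>2 + 2) * 2 ^ (n + (2 * n + 1) * (n\<^sup>2 + 1))))"
      by (rule of_nat_mono[OF num_representable_matroids_le])
    also have "\<dots> = (real n + 1) * ((real n ^ 2 + 2) *
        2 powr real (n + (2 * n + 1) * (n\<^sup>2 + 1)))"
      by (subst powr_realpow) (simp_all add: algebra_simps)
    finally show ?case
      using num_matroids_ge[OF elim] by (intro frac_le) (simp_all add: algebra_simps)
  qed
  from tendsto_sandwich[OF lower upper tendsto_const lim] show ?thesis .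
qed

end
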